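(* Let $\vec{\alpha},\vec{\beta}\in\mathbb{S}^2$ and put $W_{\vec{\alpha},\vec{\beta}}=J_{\frac{\vec{\alpha}+\vec{\beta}}{|\vec{\alpha}+\vec{\beta}|}}$ if $\vec{\alpha}\neq-\vec{\beta}$ and $W_{\vec{\alpha},\vec{\beta}}=I$ if $\vec{\alpha}=-\vec{\beta}$. Then the sets $\Sigma_{J_{\vec{\alpha}}}$ and $\Sigma_{J_{\vec{\beta}}}$ are unitarily equivalent, and $A\in\Sigma_{J_{\vec{\alpha}}}$ if and only if $W_{\vec{\alpha},\vec{\beta}}AW_{\vec{\alpha},\vec{\beta}}\in\Sigma_{J_{\vec{\beta}}}$.
   Context: $\mathfrak{H}$ is a complex Hilbert space. A fundamental symmetry is a bounded operator $K$ with $K=K^*$, $K^2=I$; it is non-trivial if $K\neq\pm I$. $J$ and $R$ are fixed non-trivial fundamental symmetries in $\mathfrak{H}$ with $JR=-RJ$. For $\vec{\alpha}=(\alpha_1,\alpha_2,\alpha_3)$ in the unit sphere $\mathbb{S}^2\subset\mathbb{R}^3$ put $J_{\vec{\alpha}}=\alpha_1J+\alpha_2R+\alpha_3\,iJR$, which is a non-trivial fundamental symmetry (so $W_{\vec{\alpha},\vec{\beta}}$ is unitary and equal to its own inverse). $S$ is a closed densely defined symmetric operator in $\mathfrak{H}$ with equal deficiency indices such that $SJ=JS$ and $SR=RS$ (operator equalities include equality of domains). $\Sigma_{J_{\vec{\alpha}}}$ is the set of all $J_{\vec{\alpha}}$-self-adjoint extensions of $S$, i.e. $\Sigma_{J_{\vec{\alpha}}}=\{A\supset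 S: J_{\vec{\alpha}}A^*=AJ_{\vec{\alpha}}\}$. Unitary equivalence of the two sets means that conjugation by one fixed unitary operator maps one set bijectively onto the other. *)

theory Defs
  imports "HOL-Analysis.Analysis"
begin

(* A complex inner product space is a real one, with respect to the real part of the complex
   inner product, so norm and topology are those of the class real_inner.
   The complex inner product is linear in its first argument. *)
class complex_inner = real_inner +
  fixes scaleC :: "complex \<Rightarrow> 'a \<Rightarrow> 'a" (infixr "*\<^sub>C" 75)
    and cinner :: "'a \<Rightarrow> 'a \<Rightarrow> complex"
  assumes scaleC_add_right: "c *\<^sub>C (x + y) = c *\<^sub>C x + c *\<^sub>C y"
    and scaleC_add_left: "(c + d) *\<^sub>C x = c *\<^sub>C x + d *\<^sub>C x"
    and scaleC_scaleC: "c *\<^sub>C d *\<^sub>C x = (c * d) *\<^sub>C x"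
    and scaleC_complex_of_real: "complex_of_real r *\<^sub>C x = r *\<^sub>R x"
    and cinner_commute: "cinner x y = cnj (cinner y x)"
    and cinner_add_left: "cinner (x + y) z = cinner x z + cinner y z"
    and cinner_scaleC_left: "cinner (c *\<^sub>C x) y = c * cinner x y"
    and Re_cinner: "Re (cinner x y) = inner x y"

class complex_hilbert_space = complex_inner + complete_space

global_interpretation complex_space:
  vector_space "scaleC :: complex \<Rightarrow> 'a \<Rightarrow> 'a::complex_inner"
  defines csubspace = complex_space.subspace
    and cspan = complex_space.span
proof
  show "1 *\<^sub>C x = x" for x :: 'a
    using scaleC_complex_of_real[of 1 x] by simp
qed (simp_all add: scaleC_add_right scaleC_add_left scaleC_scaleC)

instantiation prod :: (complex_inner, complex_inner) complex_inner
begin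

definition scaleC_prod :: "complex \<Rightarrow> 'a \<times> 'b \<Rightarrow> 'a \<times> 'b" where
  "scaleC_prod c p = (c *\<^sub>C fst p, c *\<^sub>C snd p)"

definition cinner_prod :: "'a \<times> 'b \<Rightarrow> 'a \<times> 'b \<Rightarrow> complex" where
  "cinner_prod p q = cinner (fst p) (fst q) + cinner (snd p) (snd q)"

instance
proof
  show "cinner p q = cnj (cinner q p)" for p q :: "'a \<times> 'b"
    by (metis cinner_prod_def cinner_commute complex_cnj_add)
qed (simp_all add: scaleC_prod_def cinner_prod_def scaleC_add_right scaleC_add_left
    scaleC_scaleC scaleC_complex_of_real cinner_add_left cinner_scaleC_left Re_cinner
    inner_prod_def scaleR_prod_def algebra_simps)

end

instance prod :: (complex_hilbert_space, complex_hilbert_space) complex_hilbert_space ..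


(* A possibly unbounded operator is identified with its graph, so equality and inclusion of
   operators take the domains into account, and Domain is the domain of the operator. *)
type_synonym 'a operator = "('a \<times> 'a) set"

definition linear_operator :: "'a::complex_inner operator \<Rightarrow> bool" where
  "linear_operator A \<longleftrightarrow> csubspace A \<and> single_valued A"

definition graph :: "('a \<Rightarrow> 'a) \<Rightarrow> 'a operator" where
  "graph K = {(x, K x) |x. True}"

(* The operator product: B is applied first. Relational composition is written in the
   opposite order. *)
definition op_prod :: "'a operator \<Rightarrow> 'a operator \<Rightarrow> 'a operator" (infixl "\<odot>" 70) where
  "A \<odot> B = B O A"

(* This is single-valued exactly if A is densely defined. *)
definition adj :: "'a::complex_inner operator \<Rightarrow> 'a operator" where
  "adj A = {(y, z). \<forall>(x, w)\<in>A. cinner w y = cinner x z}"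

definition densely_defined :: "'a::complex_inner operator \<Rightarrow> bool" where
  "densely_defined A \<longleftrightarrow> closure (Domain A) = UNIV"

definition closed_symmetric :: "'a::complex_inner operator \<Rightarrow> bool" where
  "closed_symmetric S \<longleftrightarrow>
     linear_operator S \<and> densely_defined S \<and> closed S \<and> S \<subseteq> adj S"

definition hilbert_basis :: "'a::complex_inner set \<Rightarrow> 'a set \<Rightarrow> bool" where
  "hilbert_basis B M \<longleftrightarrow>
     (\<forall>x\<in>B. \<forall>y\<in>B. cinner x y = (if x = y then 1 else 0)) \<and> closure (cspan B) = M"

definition same_hilbert_dim :: "'a::complex_inner set \<Rightarrow> 'a set \<Rightarrow> bool" where
  "same_hilbert_dim M N \<longleftrightarrow> (\<exists>B C. hilbert_basis B M \<and> hilbert_basis C N \<and> B \<approx> C)"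

(* The kernel of adj S - z I. *)
definition defect_subspace :: "'a::complex_inner operator \<Rightarrow> complex \<Rightarrow> 'a set" where
  "defect_subspace S z = {x. (x, z *\<^sub>C x) \<in> adj S}"

definition equal_deficiency_indices :: "'a::complex_inner operator \<Rightarrow> bool" where
  "equal_deficiency_indices S \<longleftrightarrow>
     same_hilbert_dim (defect_subspace S \<i>) (defect_subspace S (- \<i>))"

definition bounded_clinear :: "('a::complex_inner \<Rightarrow> 'a) \<Rightarrow> bool" where
  "bounded_clinear K \<longleftrightarrow> Vector_Spaces.linear (*\<^sub>C) (*\<^sub>C) K \<and> bounded_linear K"

definition unitary :: "('a::complex_inner \<Rightarrow> 'a) \<Rightarrow> bool" where
  "unitary U \<longleftrightarrow> Vector_Spaces.linear (*\<^sub>C) (*\<^sub>C) U \<and> surj U \<and>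
     (\<forall>x y. cinner (U x) (U y) = cinner x y)"

definition fundamental_symmetry :: "('a::complex_inner \<Rightarrow> 'a) \<Rightarrow> bool" where
  "fundamental_symmetry K \<longleftrightarrow>
     bounded_clinear K \<and> adj (graph K) = graph K \<and> K \<circ> K = id"

definition nontrivial_fundamental_symmetry :: "('a::complex_inner \<Rightarrow> 'a) \<Rightarrow> bool" where
  "nontrivial_fundamental_symmetry K \<longleftrightarrow>
     fundamental_symmetry K \<and> K \<noteq> id \<and> K \<noteq> uminus"

definition J_vec :: "('a::complex_inner \<Rightarrow> 'a) \<Rightarrow> ('a \<Rightarrow> 'a) \<Rightarrow> real ^ 3 \<Rightarrow> 'a \<Rightarrow> 'a" where
  "J_vec J R \<alpha> = (\<lambda>x. (\<alpha> $ 1) *\<^sub>R J x + (\<alpha> $ 2) *\<^sub>R R x + (\<alpha> $ 3) *\<^sub>R \<i> *\<^sub>C J (R x))"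

definition Sigma_J :: "('a::complex_inner \<Rightarrow> 'a) \<Rightarrow> 'a operator \<Rightarrow> 'a operator set" where
  "Sigma_J K S =
     {A. linear_operator A \<and> S \<subseteq> A \<and> graph K \<odot> adj A = A \<odot> graph K}"

definition W_op ::
    "('a::complex_inner \<Rightarrow> 'a) \<Rightarrow> ('a \<Rightarrow> 'a) \<Rightarrow> real ^ 3 \<Rightarrow> real ^ 3 \<Rightarrow> 'a \<Rightarrow> 'a" where
  "W_op J R \<alpha> \<beta> =
     (if \<alpha> \<noteq> - \<beta> then J_vec J R ((\<alpha> + \<beta>) /\<^sub>R norm (\<alpha> + \<beta>)) else id)"

definition unitarily_equivalent :: "'a::complex_inner operator set \<Rightarrow> 'a operator set \<Rightarrow> bool" where
  "unitarily_equivalent X Y \<longleftrightarrow>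
     (\<exists>U. unitary U \<and> bij_betw (\<lambda>A. graph U \<odot> A \<odot> graph (inv U)) X Y)"

end

theory Submission
  imports Defs
begin

text \<open>
  The operators \<open>J\<close>, \<open>R\<close>, \<open>\<i>JR\<close> satisfy the relations of the Pauli matrices, so
  \<open>J_\<alpha> J_\<beta> + J_\<beta> J_\<alpha> = 2 (\<alpha> \<bullet> \<beta>) I\<close>. Hence conjugation by \<open>J_\<gamma>\<close> with \<open>|\<gamma>| = 1\<close> sends \<open>J_\<alpha>\<close> to
  \<open>J_\<alpha>'\<close>, where \<open>\<alpha>' = 2 (\<gamma> \<bullet> \<alpha>) \<gamma> - \<alpha>\<close> is the half-turn of \<open>\<alpha>\<close> about \<open>\<gamma>\<close>; for \<open>\<gamma>\<close> the midpoint
  direction of \<open>\<alpha>\<close> and \<open>\<beta>\<close> this is \<open>\<beta>\<close>. Since \<open>J_\<gamma>\<close> commutes with \<open>S\<close>, this conjugation carries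
  \<open>J_\<alpha>\<close>-self-adjoint extensions of \<open>S\<close> to \<open>J_\<beta>\<close>-self-adjoint ones. If \<open>\<alpha> = - \<beta>\<close>, then
  \<open>J_\<beta> = - J_\<alpha>\<close> and the two sets of extensions coincide.
\<close>

section \<open>Complex inner products and symmetric involutions\<close>

lemma cinner_scaleC_right: "cinner x (c *\<^sub>C y) = cnj c * cinner x y"
  by (metis cinner_commute cinner_scaleC_left complex_cnj_mult)

lemma cinner_add_right: "cinner x (y + z) = cinner x y + cinner x z"
  by (metis cinner_commute cinner_add_left complex_cnj_add)

lemma cinner_minus_right: "cinner x (- y) = - cinner x y"
  using cinner_scaleC_right[of x "-1" y] by simp

lemma scaleR_eq_scaleC: "r *\<^sub>R x = complex_of_real r *\<^sub>C (x::'a::complex_inner)"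
  by (simp add: scaleC_complex_of_real)

lemma csubspace_scaleR:
  assumes "csubspace V" "x \<in> V"
  shows "r *\<^sub>R x \<in> V"
  using assms by (simp add: scaleR_eq_scaleC complex_space.subspace_scale)

text \<open>The equational content of a fundamental symmetry, in a form that \<open>id\<close> also
  satisfies, so that both cases of \<open>W_op\<close> are covered. Such a map preserves the inner
  product, since \<open>cinner (K x) (K y) = cinner x (K (K y))\<close>.\<close>

definition symmetric_involution :: "('a::complex_inner \<Rightarrow> 'a) \<Rightarrow> bool" where
  "symmetric_involution K \<longleftrightarrow> Vector_Spaces.linear (*\<^sub>C) (*\<^sub>C) K \<and> (\<forall>x. K (K x) = x) \<and>
     (\<forall>x y. cinner (K x) y = cinner x (K y))"

lemma clinear_iff:
  fixes K :: "'a::complex_inner \<Rightarrow> 'a"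
  shows "Vector_Spaces.linear (*\<^sub>C) (*\<^sub>C) K \<longleftrightarrow>
    (\<forall>x y. K (x + y) = K x + K y) \<and> (\<forall>c x. K (c *\<^sub>C x) = c *\<^sub>C K x)"
  by (simp add: Vector_Spaces.linear_iff complex_space.vector_space_axioms)

lemma symmetric_involutionD:
  assumes "symmetric_involution K"
  shows "K (x + y) = K x + K y" "K (c *\<^sub>C x) = c *\<^sub>C K x" "K (r *\<^sub>R x) = r *\<^sub>R K x"
    "K (- x) = - K x" "K (K x) = x" "cinner (K x) y = cinner x (K y)" "K (x - y) = K x - K y"
proof -
  show *: "K (x + y) = K x + K y" "K (c *\<^sub>C x) = c *\<^sub>C K x" "K (K x) = x"
    "cinner (K x) y = cinner x (K y)" for x y c
    using assms by (auto simp: symmetric_involution_def clinear_iff)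
  show **: "K (r *\<^sub>R x) = r *\<^sub>R K x" for r x
    by (simp add: scaleR_eq_scaleC *)
  show ***: "K (- x) = - K x" for x
    using **[of "-1" x] by simp
  show "K (x - y) = K x - K y"
    using *(1)[of x "- y"] by (simp add: ***)
qed

lemma symmetric_involution_id: "symmetric_involution (id :: 'a::complex_inner \<Rightarrow> 'a)"
  by (simp add: symmetric_involution_def clinear_iff)

lemma symmetric_involution_fundamental_symmetry:
  assumes "fundamental_symmetry K"
  shows "symmetric_involution K"
proof -
  have "cinner (K x) y = cinner x (K y)" for x y
  proof -
    have "(y, K y) \<in> adj (graph K)"
      using assms by (auto simp: fundamental_symmetry_def graph_def)
    then show ?thesis
      by (auto simp: adj_def graph_def)
  qed
  then show ?thesis
    using assms unfolding fundamental_symmetry_def symmetric_involution_def bounded_clinear_def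
    by (metis comp_apply id_apply)
qed

lemma unitary_symmetric_involution:
  assumes "symmetric_involution W"
  shows "unitary W"
  unfolding unitary_def
proof (intro conjI allI)
  show "surj W"
    by (metis symmetric_involutionD(5)[OF assms] surjI)
qed (use assms in \<open>auto simp: symmetric_involution_def\<close>)

lemma inv_symmetric_involution:
  assumes "symmetric_involution W"
  shows "inv W = W"
  by (rule inv_unique_comp) (auto simp: symmetric_involutionD(5)[OF assms])

section \<open>Conjugation of operators by an involution, and its effect on
  \<open>Sigma_J\<close>\<close>

definition conj_op :: "('a \<Rightarrow> 'a) \<Rightarrow> 'a operator \<Rightarrow> 'a operator" where
  "conj_op W A = graph W \<odot> A \<odot> graph W"

lemma mem_conj_op:
  assumes "symmetric_involution W"
  shows "(x, y) \<in> conj_op W A \<longleftrightarrow> (W x, W y) \<in> A"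
  using symmetric_involutionD(5)[OF assms]
  by (force simp: conj_op_def op_prod_def graph_def relcomp_unfold)

lemma conj_op_conj_op:
  assumes "symmetric_involution W"
  shows "conj_op W (conj_op W A) = A"
  by (auto simp: mem_conj_op[OF assms] symmetric_involutionD[OF assms])

lemma csubspace_operator_iff:
  "csubspace (A :: 'a::complex_inner operator) \<longleftrightarrow> (0, 0) \<in> A \<and>
    (\<forall>x y u v. (x, y) \<in> A \<longrightarrow> (u, v) \<in> A \<longrightarrow> (x + u, y + v) \<in> A) \<and>
    (\<forall>c x y. (x, y) \<in> A \<longrightarrow> (c *\<^sub>C x, c *\<^sub>C y) \<in> A)"
  by (simp add: complex_space.subspace_def Ball_def scaleC_prod_def zero_prod_def)

lemma linear_operator_conj_op:
  assumes W: "symmetric_involution W" and "linear_operator A"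
  shows "linear_operator (conj_op W A)"
proof -
  have "W 0 = 0"
    using symmetric_involutionD(3)[OF W, of 0 0] by simp
  moreover have "single_valued (conj_op W A)"
    using assms(2) unfolding single_valued_def linear_operator_def mem_conj_op[OF W]
    by (metis symmetric_involutionD(5)[OF W])
  ultimately show ?thesis
    using assms(2)
    by (auto simp: linear_operator_def csubspace_operator_iff mem_conj_op[OF W]
        symmetric_involutionD[OF W])
qed

lemma linear_operator_conj_op_iff:
  assumes "symmetric_involution W"
  shows "linear_operator (conj_op W A) \<longleftrightarrow> linear_operator A"
  using linear_operator_conj_op[OF assms, of A] linear_operator_conj_op[OF assms, of "conj_op W A"]
  by (auto simp: conj_op_conj_op[OF assms])

text \<open>This is (WAW)* = W A* W. As \<open>W\<close> is a bijection, the quantified pair may be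
  replaced by its image under \<open>W\<close>; symmetry then moves \<open>W\<close> to the other
  side of each inner product.\<close>

lemma mem_adj_conj_op:
  assumes W: "symmetric_involution W"
  shows "(x, y) \<in> adj (conj_op W A) \<longleftrightarrow> (W x, W y) \<in> adj A"
proof -
  have "(\<forall>u v. (W u, W v) \<in> A \<longrightarrow> cinner v x = cinner u y) \<longleftrightarrow>
        (\<forall>u v. (u, v) \<in> A \<longrightarrow> cinner (W v) x = cinner (W u) y)"
    by (metis symmetric_involutionD(5)[OF W])
  then show ?thesis
    by (auto simp: adj_def mem_conj_op[OF W] symmetric_involutionD[OF W])
qed

text \<open>Because \<open>K\<close> is its own inverse, \<open>z = K u\<close> means
  \<open>u = K z\<close>, which removes the intermediate point from both operator products.\<close>

lemma Sigma_J_iff: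
  assumes "symmetric_involution K"
  shows "A \<in> Sigma_J K S \<longleftrightarrow>
    linear_operator A \<and> S \<subseteq> A \<and> (\<forall>x z. (x, K z) \<in> adj A \<longleftrightarrow> (K x, z) \<in> A)"
proof -
  have "(x, z) \<in> graph K \<odot> adj A \<longleftrightarrow> (x, K z) \<in> adj A" for x z
    using symmetric_involutionD(5)[OF assms]
    by (force simp: op_prod_def graph_def relcomp_unfold)
  moreover have "(x, z) \<in> A \<odot> graph K \<longleftrightarrow> (K x, z) \<in> A" for x z
    by (auto simp: op_prod_def graph_def relcomp_unfold)
  ultimately show ?thesis
    by (auto simp: Sigma_J_def set_eq_iff)
qed

text \<open>The intertwining relation WL = KW turns the condition on \<open>conj_op W A\<close> and
  \<open>L\<close> at a pair \<open>(x, z)\<close> into the condition on \<open>A\<close> and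
  \<open>K\<close> at \<open>(W x, W z)\<close>. These pairs exhaust the whole space.\<close>

lemma conj_op_in_Sigma_J_iff:
  assumes W: "symmetric_involution W" and K: "symmetric_involution K"
    and L: "symmetric_involution L" and conj: "\<And>x. W (K (W x)) = L x"
    and S: "conj_op W S = S"
  shows "conj_op W A \<in> Sigma_J L S \<longleftrightarrow> A \<in> Sigma_J K S"
proof -
  have WL: "W (L x) = K (W x)" for x
    using conj symmetric_involutionD(5)[OF W] by metis
  have "S \<subseteq> conj_op W A \<longleftrightarrow> S \<subseteq> A"
  proof -
    \<comment> \<open>Monotonicity yields both directions, as \<open>conj_op W\<close> fixes
      \<open>S\<close> and is its own inverse.\<close>
    have "conj_op W B \<subseteq> conj_op W C" if "B \<subseteq> C" for B C
      using that by (auto simp: mem_conj_op[OF W])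
    from this[of S A] this[of S "conj_op W A"] show ?thesis
      by (auto simp: S conj_op_conj_op[OF W])
  qed
  moreover have "(\<forall>x z. (x, L z) \<in> adj (conj_op W A) \<longleftrightarrow> (L x, z) \<in> conj_op W A) \<longleftrightarrow>
      (\<forall>x z. (x, K z) \<in> adj A \<longleftrightarrow> (K x, z) \<in> A)"
    (is "_ \<longleftrightarrow> (\<forall>x z. ?P x z)")
  proof -
    have "(\<forall>x z. ?P (W x) (W z)) \<longleftrightarrow> (\<forall>x z. ?P x z)"
      using symmetric_involutionD(5)[OF W] by metis
    then show ?thesis
      by (simp only: mem_adj_conj_op[OF W] mem_conj_op[OF W] WL)
  qed
  ultimately show ?thesis
    by (simp add: Sigma_J_iff[OF K] Sigma_J_iff[OF L] linear_operator_conj_op_iff[OF W])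
qed

lemma unitarily_equivalent_conj_op:
  assumes W: "symmetric_involution W"
    and "\<And>A. conj_op W A \<in> Y \<longleftrightarrow> A \<in> X"
  shows "unitarily_equivalent X Y"
  unfolding unitarily_equivalent_def
proof (intro exI conjI)
  show "unitary W"
    using W by (rule unitary_symmetric_involution)
  have X: "conj_op W A \<in> X" if "A \<in> Y" for A
    using assms(2)[of "conj_op W A"] that by (simp add: conj_op_conj_op[OF W])
  have "bij_betw (conj_op W) X Y"
  proof (rule bij_betw_byWitness[where f' = "conj_op W"])
    show "conj_op W ` X \<subseteq> Y"
      using assms(2) by blast
    show "conj_op W ` Y \<subseteq> X"
      using X by blast
  qed (simp_all add: conj_op_conj_op[OF W])
  then show "bij_betw (\<lambda>A. graph W \<odot> A \<odot> graph (inv W)) X Y"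
    by (simp add: conj_op_def[abs_def] inv_symmetric_involution[OF W])
qed

lemma adj_uminus:
  "(- x, - y) \<in> adj A \<longleftrightarrow> (x, y) \<in> adj A"
  by (simp add: adj_def cinner_minus_right)

lemma Sigma_J_uminus:
  assumes K: "symmetric_involution K" and L: "symmetric_involution L" and "\<And>x. L x = - K x"
  shows "Sigma_J L S = Sigma_J K S"
proof -
  have "(\<forall>x z. (x, L z) \<in> adj A \<longleftrightarrow> (L x, z) \<in> A) \<longleftrightarrow>
    (\<forall>x z. (x, K z) \<in> adj A \<longleftrightarrow> (K x, z) \<in> A)" for A
  proof -
    \<comment> \<open>In \<open>adj A\<close> the sign of \<open>L z\<close> passes to the first
      component, in \<open>A\<close> it passes inside \<open>K\<close>. So the condition for
      \<open>L\<close> at \<open>x\<close> is the condition for \<open>K\<close> at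
      \<open>- x\<close>.\<close>
    have *: "(x, L z) \<in> adj A \<longleftrightarrow> (- x, K z) \<in> adj A" "(L x, z) \<in> A \<longleftrightarrow> (K (- x), z) \<in> A" for x z
      using adj_uminus[of x "- K z" A] by (simp_all add: assms(3) symmetric_involutionD(4)[OF K])
    have "(\<forall>x. P (- x)) \<longleftrightarrow> (\<forall>x. P x)" for P :: "'a \<Rightarrow> bool"
      by (metis minus_minus)
    from this[of "\<lambda>x. \<forall>z. (x, K z) \<in> adj A \<longleftrightarrow> (K x, z) \<in> A"] show ?thesis
      by (simp only: *)
  qed
  then show ?thesis
    by (intro set_eqI) (simp only: Sigma_J_iff[OF K] Sigma_J_iff[OF L])
qed

lemma mem_commuting_operator:
  assumes K: "symmetric_involution K" and "S \<odot> graph K = graph K \<odot> S" and "(x, y) \<in> S"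
  shows "(K x, K y) \<in> S"
proof -
  have "(K x, x) \<in> graph K"
    by (simp add: graph_def symmetric_involutionD(5)[OF K])
  with assms(3) have "(K x, y) \<in> S \<odot> graph K"
    by (auto simp: op_prod_def)
  then have "(K x, y) \<in> graph K \<odot> S"
    by (simp only: assms(2))
  then obtain u where "(K x, u) \<in> S" "y = K u"
    by (auto simp: op_prod_def graph_def)
  then show ?thesis
    by (simp add: symmetric_involutionD(5)[OF K])
qed

section \<open>The Clifford relations of J, R and iJR\<close>

context
  fixes J R :: "'a::complex_inner \<Rightarrow> 'a"
  assumes J: "symmetric_involution J" and R: "symmetric_involution R"
    and anticommute: "\<And>x. J (R x) = - R (J x)"
begin

lemma J_vec_clinear: "Vector_Spaces.linear (*\<^sub>C) (*\<^sub>C) (J_vec J R v)"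
  unfolding clinear_iff J_vec_def
  by (simp add: scaleR_eq_scaleC scaleC_add_right scaleC_scaleC symmetric_involutionD[OF J]
      symmetric_involutionD[OF R] mult_ac)

lemma J_vec_symmetric: "cinner (J_vec J R v x) y = cinner x (J_vec J R v y)"
proof -
  \<comment> \<open>The adjoint of JR is RJ = -JR, so JR is skew; the factor \<open>\<i>\<close>,
    conjugated in the second argument, makes iJR symmetric.\<close>
  have "cinner (J (R x)) y = - cinner x (J (R y))"
  proof -
    have "cinner (J (R x)) y = cinner x (R (J y))"
      by (simp add: symmetric_involutionD(6)[OF J] symmetric_involutionD(6)[OF R])
    also have "R (J y) = - J (R y)"
      using anticommute[of y] by simp
    finally show ?thesis
      by (simp add: cinner_minus_right)
  qed
  then show ?thesis
    unfolding J_vec_def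
    by (simp add: scaleR_eq_scaleC cinner_add_left cinner_add_right cinner_scaleC_left
        cinner_scaleC_right symmetric_involutionD(6)[OF J] symmetric_involutionD(6)[OF R])
qed

text \<open>The three generators square to I and anticommute pairwise, so the mixed terms cancel and
  only the products of equal coordinates survive.\<close>

lemma J_vec_anticommutator:
  "J_vec J R u (J_vec J R v x) + J_vec J R v (J_vec J R u x) = (2 * (u \<bullet> v)) *\<^sub>R x"
proof -
  \<comment> \<open>Oriented to bring every word in \<open>J\<close> and \<open>R\<close> to the
    form with \<open>J\<close> outermost.\<close>
  have RJ: "R (J y) = - J (R y)" for y
    using anticommute[of y] by simp
  have i: "\<i> *\<^sub>C (r *\<^sub>R y) = r *\<^sub>R (\<i> *\<^sub>C y)" "\<i> *\<^sub>C (- y) = - (\<i> *\<^sub>C y)"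
    "\<i> *\<^sub>C (\<i> *\<^sub>C y) = - y" for r and y :: 'a
    by (simp_all add: scaleR_eq_scaleC scaleC_scaleC mult.commute)
  show ?thesis
    unfolding J_vec_def inner_vec_def
    by (simp add: sum_3 symmetric_involutionD[OF J] symmetric_involutionD[OF R] RJ i
        scaleC_add_right algebra_simps)
      (simp flip: scaleR_add_left add: scaleR_2)
qed

lemma J_vec_scaleR_diff: "J_vec J R (r *\<^sub>R u - v) x = r *\<^sub>R J_vec J R u x - J_vec J R v x"
  by (simp add: J_vec_def algebra_simps)

lemma J_vec_uminus: "J_vec J R (- v) x = - J_vec J R v x"
  using J_vec_scaleR_diff[of 0 0 v x] by simp

lemma J_vec_involution:
  assumes "norm v = 1"
  shows "J_vec J R v (J_vec J R v x) = x"
  using J_vec_anticommutator[of v v x] assms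
  by (simp add: dot_square_norm flip: scaleR_2)

lemma symmetric_involution_J_vec:
  assumes "norm v = 1"
  shows "symmetric_involution (J_vec J R v)"
  unfolding symmetric_involution_def
  using J_vec_clinear J_vec_symmetric J_vec_involution[OF assms] by simp

lemma J_vec_conjugate:
  assumes "norm w = 1"
  shows "J_vec J R w (J_vec J R v (J_vec J R w x)) = J_vec J R ((2 * (w \<bullet> v)) *\<^sub>R w - v) x"
proof -
  have "J_vec J R w (J_vec J R v (J_vec J R w x)) =
      (2 * (w \<bullet> v)) *\<^sub>R J_vec J R w x - J_vec J R v (J_vec J R w (J_vec J R w x))"
    \<comment> \<open>The anticommutator moves the outer factor past the middle one, next to its
      copy, where the two cancel.\<close>
    using J_vec_anticommutator[of w v "J_vec J R w x"] by (simp add: algebra_simps)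
  then show ?thesis
    by (simp add: J_vec_involution[OF assms] J_vec_scaleR_diff)
qed

lemma J_vec_mem_operator:
  assumes "csubspace S" "S \<odot> graph J = graph J \<odot> S" "S \<odot> graph R = graph R \<odot> S"
    and "(x, y) \<in> S"
  shows "(J_vec J R v x, J_vec J R v y) \<in> S"
proof -
  note mJ = mem_commuting_operator[OF J assms(2)] and mR = mem_commuting_operator[OF R assms(3)]
  have "(v $ 1) *\<^sub>R (J x, J y) + (v $ 2) *\<^sub>R (R x, R y) + (v $ 3) *\<^sub>R \<i> *\<^sub>C (J (R x), J (R y)) \<in> S"
    using assms(4)
    by (intro complex_space.subspace_add csubspace_scaleR complex_space.subspace_scale assms(1)
        mJ mR)
  then show ?thesis
    by (simp add: J_vec_def scaleC_prod_def)
qed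

lemma conj_op_J_vec:
  assumes "csubspace S" "S \<odot> graph J = graph J \<odot> S" "S \<odot> graph R = graph R \<odot> S"
    and "norm v = 1"
  shows "conj_op (J_vec J R v) S = S"
proof -
  have "(x, y) \<in> S" if "(J_vec J R v x, J_vec J R v y) \<in> S" for x y
    using J_vec_mem_operator[OF assms(1-3) that, of v] by (simp add: J_vec_involution[OF assms(4)])
  then have "(x, y) \<in> conj_op (J_vec J R v) S \<longleftrightarrow> (x, y) \<in> S" for x y
    unfolding mem_conj_op[OF symmetric_involution_J_vec[OF assms(4)]]
    using J_vec_mem_operator[OF assms(1-3), of x y v] by blast
  then show ?thesis
    by (intro set_eqI) (simp only: split_paired_all)
qed

end

section \<open>The half-turn exchanging two unit vectors, and the conclusion\<close>

lemma half_turn_midpoint: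
  fixes u v :: "'a::real_inner"
  assumes "norm u = 1" "norm v = 1" "u + v \<noteq> 0"
  defines "w \<equiv> (u + v) /\<^sub>R norm (u + v)"
  shows "(2 * (w \<bullet> u)) *\<^sub>R w - u = v"
proof -
  have "u \<bullet> u = 1" "v \<bullet> v = 1"
    using assms(1,2) by (simp_all add: dot_square_norm)
  \<comment> \<open>For unit vectors both sides equal 2 + 2 (u \<bullet> v). Hence
    \<open>2 * (w \<bullet> u)\<close> is exactly the norm by which \<open>w\<close> was
    normalised.\<close>
  then have "2 * ((u + v) \<bullet> u) = norm (u + v) ^ 2"
    by (simp add: power2_norm_eq_inner inner_add_left inner_add_right inner_commute)
  moreover have "2 * (w \<bullet> u) = 2 * ((u + v) \<bullet> u) / norm (u + v)"
    by (simp add: w_def divide_inverse mult_ac)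
  ultimately have "2 * (w \<bullet> u) = norm (u + v)"
    using assms(3) by (simp add: power2_eq_square)
  then show ?thesis
    using assms(3) by (simp add: w_def)
qed

theorem theorem2p9:
  fixes J R :: "'a::complex_hilbert_space \<Rightarrow> 'a"
    and S :: "'a operator"
    and \<alpha> \<beta> :: "real ^ 3"
  assumes "nontrivial_fundamental_symmetry J"
    and "nontrivial_fundamental_symmetry R"
    and "\<And>x. J (R x) = - R (J x)"
    and "closed_symmetric S"
    and "equal_deficiency_indices S"
    and "S \<odot> graph J = graph J \<odot> S"
    and "S \<odot> graph R = graph R \<odot> S"
    and "\<alpha> \<in> sphere 0 1"
    and "\<beta> \<in> sphere 0 1"
  shows "unitarily_equivalent (Sigma_J (J_vec J R \<alpha>) S) (Sigma_J (J_vec J R \<beta>) S) \<and>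
    (\<forall>A. linear_operator A \<longrightarrow>
       (A \<in> Sigma_J (J_vec J R \<alpha>) S \<longleftrightarrow>
        graph (W_op J R \<alpha> \<beta>) \<odot> A \<odot> graph (W_op J R \<alpha> \<beta>) \<in> Sigma_J (J_vec J R \<beta>) S))"
proof -
  have J: "symmetric_involution J" and R: "symmetric_involution R"
    using assms(1,2)
    by (auto simp: nontrivial_fundamental_symmetry_def
        intro: symmetric_involution_fundamental_symmetry)
  note JR = J R assms(3)
  have S: "csubspace S"
    using assms(4) by (simp add: closed_symmetric_def linear_operator_def)
  have norm: "norm \<alpha> = 1" "norm \<beta> = 1"
    using assms(8,9) by auto
  note K = symmetric_involution_J_vec[of J R, OF JR norm(1)] and L = symmetric_involution_J_vec[of J R, OF JR norm(2)]
  let ?W = "W_op J R \<alpha> \<beta>"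
  \<comment> \<open>This single equivalence serves both conclusions: it contains the membership
    criterion, and for an involution it also makes conjugation a bijection between the two
    sets.\<close>
  have "symmetric_involution ?W \<and>
    (\<forall>A. conj_op ?W A \<in> Sigma_J (J_vec J R \<beta>) S \<longleftrightarrow> A \<in> Sigma_J (J_vec J R \<alpha>) S)"
  proof (cases "\<alpha> = - \<beta>")
    case True
    have "conj_op id A = A" for A :: "'a operator"
      by (auto simp: mem_conj_op[OF symmetric_involution_id])
    moreover have "Sigma_J (J_vec J R \<alpha>) S = Sigma_J (J_vec J R \<beta>) S"
      by (rule Sigma_J_uminus[OF L K]) (simp add: True J_vec_uminus[of J R, OF JR])
    ultimately show ?thesis
      using True by (simp add: W_op_def symmetric_involution_id)
  next
    case False
    define w where "w = (\<alpha> + \<beta>) /\<^sub>R norm (\<alpha> + \<beta>)"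
    have nz: "\<alpha> + \<beta> \<noteq> 0"
      using False by (simp add: eq_neg_iff_add_eq_0)
    then have w: "norm w = 1"
      by (simp add: w_def)
    have W: "?W = J_vec J R w"
      using False by (simp add: W_op_def w_def)
    have "J_vec J R w (J_vec J R \<alpha> (J_vec J R w x)) = J_vec J R \<beta> x" for x
      unfolding J_vec_conjugate[of J R, OF JR w]
      using half_turn_midpoint[OF norm nz, folded w_def] by simp
    then show ?thesis
      unfolding W
      using conj_op_in_Sigma_J_iff[OF symmetric_involution_J_vec[of J R, OF JR w] K L]
        conj_op_J_vec[of J R, OF JR S assms(6,7) w] symmetric_involution_J_vec[of J R, OF JR w] by blast
  qed
  then show ?thesis
    using unitarily_equivalent_conj_op[of ?W] unfolding conj_op_def by blast
qed

end
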